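(* Let $G$ and $H$ be graphs. Let $k=k_1+\cdots+k_l$ with positive integers $k_i$, and index colors as pairs $(i,j)$ with $i\in\{1,\ldots,l\}$, $j\in\{1,\ldots,k_i\}$ (the second index taken modulo $k_i$). Let $g$ be a perfect $k$-coloring of $G$ whose quotient matrix has block form $$S=\begin{pmatrix}A_{1,1}&A_{1,2}&\cdots&A_{1,l}\\ \vdots&&&\vdots\\ A_{l,1}&A_{l,2}&\cdots&A_{l,l}\end{pmatrix},$$ where each $A_{i,i}$ is an equal-diagonal $k_i\times k_i$ matrix and, for $i\ne j$, $A_{i,j}=a_{i,j}J_{k_i\times k_j}$ for some integer $a_{i,j}$. For each $i$ let $h_i$ be a perfect $k_i$-coloring of $H$ with equal-diagonal quotient matrix $B_i$. Then there is a perfect coloring of $G\times H$ with quotient matrix $$\begin{pmatrix}A_{1,1}+B_1&A_{1,2}&\cdots&A_{1,l}\\ A_{2,1}&A_{2,2}+B_2&\cdots&A_{2,l}\\ \vdots&&\ddots&\vdots\\ A_{l,1}&A_{l,2}&\cdots&A_{l,l}+B_l\end{pmatrix}.$$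
   Context: $G\times H$ denotes the Cartesian product: vertices $(x,y)$, with $(x,y)$ adjacent to $(x',y')$ iff either $x=x'$ and $y,y'$ adjacent in $H$, or $y=y'$ and $x,x'$ adjacent in $G$. A $k$-coloring is a surjective map onto a $k$-element set of colors; it is perfect with quotient matrix $S=(s_{ij})$ if every vertex of color $i$ has exactly $s_{ij}$ neighbours of color $j$. An $t\times t$ matrix $M=(m_{i,j})$ is equal-diagonal if $m_{i,j}=m_{i+1,j+1}$ for all $i,j$, indices taken modulo $t$. $J_{p\times q}$ is the all-ones $p\times q$ matrix. *)

theory Defs
  imports "Graph_Theory.Pair_Digraph" "Jordan_Normal_Form.Matrix"
begin

text \<open>
  A simple undirected graph, finite or infinite, is a loop-free symmetric digraph without
  parallel arcs, i.e. an instance of the locale \<^locale>\<open>pair_bidirected_digraph\<close>.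
\<close>

definition cartesian_product ::
  "'a pair_pre_digraph \<Rightarrow> 'b pair_pre_digraph \<Rightarrow> ('a \<times> 'b) pair_pre_digraph" (infixr "\<box>" 80)
where
  "G \<box> H = \<lparr> pverts = pverts G \<times> pverts H,
     parcs = {((x, y), (x', y')). (x = x' \<and> x \<in> pverts G \<and> (y, y') \<in> parcs H) \<or>
                                  (y = y' \<and> y \<in> pverts H \<and> (x, x') \<in> parcs G)} \<rparr>"

lemma pair_bidirected_digraph_cartesian_product:
  assumes "pair_bidirected_digraph G" and "pair_bidirected_digraph H"
  shows "pair_bidirected_digraph (G \<box> H)"
proof -
  interpret G: pair_bidirected_digraph G by (rule assms(1))
  interpret H: pair_bidirected_digraph H by (rule assms(2))
  show ?thesis
    using G.pair_sym_arcs H.pair_sym_arcs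
    by unfold_locales
      (auto simp: cartesian_product_def symmetric_def intro!: symI
        dest: symD G.in_arcsD1 G.in_arcsD2 H.in_arcsD1 H.in_arcsD2 G.pair_no_loops H.pair_no_loops)
qed

definition coloring :: "'a pair_pre_digraph \<Rightarrow> nat \<Rightarrow> 'c set \<Rightarrow> ('a \<Rightarrow> 'c) \<Rightarrow> bool" where
  "coloring G k C f \<longleftrightarrow> finite C \<and> card C = k \<and> f ` pverts G = C"

text \<open>
  Finiteness is required explicitly because \<^const>\<open>card\<close> is 0 on infinite sets.
\<close>

definition perfect_coloring ::
  "'a pair_pre_digraph \<Rightarrow> nat \<Rightarrow> 'c set \<Rightarrow> ('c \<Rightarrow> 'c \<Rightarrow> int) \<Rightarrow> ('a \<Rightarrow> 'c) \<Rightarrow> bool"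
where
  "perfect_coloring G k C S f \<longleftrightarrow> coloring G k C f \<and>
     (\<forall>v \<in> pverts G. \<forall>c \<in> C.
        finite {w. (v, w) \<in> parcs G \<and> f w = c} \<and>
        int (card {w. (v, w) \<in> parcs G \<and> f w = c}) = S (f v) c)"

text \<open>Rows and columns are numbered from 0.\<close>

definition equal_diagonal :: "nat \<Rightarrow> 'e mat \<Rightarrow> bool" where
  "equal_diagonal t M \<longleftrightarrow> M \<in> carrier_mat t t \<and>
     (\<forall>i < t. \<forall>j < t. M $$ (i, j) = M $$ ((i + 1) mod t, (j + 1) mod t))"

definition all_ones_mat :: "nat \<Rightarrow> nat \<Rightarrow> int mat" where
  "all_ones_mat p q = mat p q (\<lambda>_. 1)"

text \<open>
  The colors (equivalently, the row and column indices of a block matrix with \<open>l \<times> l\<close> blocks whose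
  \<open>(i, j)\<close> block has size \<open>ks i \<times> ks j\<close>) are pairs consisting of a block number and a position inside
  that block, both numbered from 0.
\<close>

definition block_indices :: "nat \<Rightarrow> (nat \<Rightarrow> nat) \<Rightarrow> (nat \<times> nat) set" where
  "block_indices l ks = (SIGMA i:{..<l}. {..<ks i})"

lemma finite_block_indices: "finite (block_indices l ks)"
  by (simp add: block_indices_def)

lemma card_block_indices: "card (block_indices l ks) = (\<Sum>i<l. ks i)"
  by (simp add: block_indices_def)

definition block_matrix :: "(nat \<Rightarrow> nat \<Rightarrow> int mat) \<Rightarrow> nat \<times> nat \<Rightarrow> nat \<times> nat \<Rightarrow> int" where
  "block_matrix A = (\<lambda>(i, p) (j, q). A i j $$ (p, q))"

end

theory Submission
  imports Defs "HOL-Number_Theory.Cong"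
begin

text \<open>
  If \<open>g x = (i, p)\<close>, color \<open>(x, y)\<close> by \<open>(i, p + h\<^sub>i y)\<close>, the second component taken modulo
  \<open>k\<^sub>i\<close>. For a fixed \<open>y\<close> this cyclically permutes the colors inside each block of \<open>g\<close>, and for a
  fixed \<open>x\<close> it is a cyclic relabelling of \<open>h\<^sub>i\<close>. Equal-diagonal blocks and constant blocks are
  invariant under the permutations involved.
\<close>

lemma equal_diagonal_carrier: "equal_diagonal t M \<Longrightarrow> M \<in> carrier_mat t t"
  by (simp only: equal_diagonal_def)

text \<open>Iterating the one-step invariance gives invariance under any simultaneous cyclic shift.
  The bounds on \<open>i\<close> and \<open>j\<close> make the shift by 0 the identity.\<close>

lemma equal_diagonal_shift:
  assumes "equal_diagonal t M" and "i < t" and "j < t"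
  shows "M $$ ((i + n) mod t, (j + n) mod t) = M $$ (i, j)"
proof (induction n)
  case 0
  then show ?case using assms by simp
next
  case (Suc n)
  have "M $$ ((i + n) mod t, (j + n) mod t)
      = M $$ (((i + n) mod t + 1) mod t, ((j + n) mod t + 1) mod t)"
    using assms unfolding equal_diagonal_def by (meson mod_less_divisor le_less_trans zero_le)
  then show ?case using Suc by (simp add: mod_simps)
qed

text \<open>Translation by \<open>b\<close> permutes the residues modulo \<open>t\<close>. This
  turns a condition on a shifted color into a condition on the original one, so that the counts
  known for \<open>g\<close> and \<open>h i\<close> apply.\<close>

lemma mod_add_eq_unique:
  fixes b c t :: nat
  assumes "c < t"
  obtains p where "p < t" and "(p + b) mod t = c"
    and "\<And>q. q < t \<Longrightarrow> (q + b) mod t = c \<longleftrightarrow> q = p"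
proof
  \<comment> \<open>The witness is c - b modulo \<open>t\<close>; \<open>t - b mod t\<close>
    represents -b without truncated subtraction on \<open>nat\<close>.\<close>
  define p where "p = (c + (t - b mod t)) mod t"
  show p_less: "p < t" using assms by (simp add: p_def)
  have "b mod t \<le> t" using assms by (simp add: less_imp_le)
  then have "c + (t - b mod t) + b mod t = c + t" by simp
  moreover have "(p + b) mod t = (c + (t - b mod t) + b mod t) mod t"
    unfolding p_def by (metis mod_add_eq mod_mod_trivial)
  ultimately show p_eq: "(p + b) mod t = c" using assms by (metis mod_add_self2 mod_less)
  show "(q + b) mod t = c \<longleftrightarrow> q = p" if "q < t" for q
  proof
    assume "(q + b) mod t = c"
    then have "[q + b = p + b] (mod t)" using p_eq by (simp add: cong_def)
    then have "[q = p] (mod t)" by (simp add: cong_add_rcancel_nat)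
    then show "q = p" using that p_less by (simp add: cong_def)
  qed (use p_eq in simp)
qed

lemma perfect_coloring_card:
  assumes "perfect_coloring G k C S f" and "v \<in> pverts G" and "c \<in> C"
  shows "finite {w. (v, w) \<in> parcs G \<and> f w = c}"
    and "int (card {w. (v, w) \<in> parcs G \<and> f w = c}) = S (f v) c"
  using assms by (auto simp: perfect_coloring_def)

lemma perfect_coloring_in_colors:
  assumes "perfect_coloring G k C S f" and "v \<in> pverts G"
  shows "f v \<in> C"
  using assms by (auto simp: perfect_coloring_def coloring_def)

lemma cartesian_product_neighbors:
  assumes "x \<in> pverts G" and "y \<in> pverts H"
  shows "{w. ((x, y), w) \<in> parcs (G \<box> H) \<and> P w}
    = (\<lambda>x'. (x', y)) ` {x'. (x, x') \<in> parcs G \<and> P (x', y)}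
      \<union> Pair x ` {y'. (y, y') \<in> parcs H \<and> P (x, y')}"
  using assms by (auto simp: cartesian_product_def)

text \<open>The neighbors along \<open>G\<close> and those along \<open>H\<close> are disjoint: a
  common one would be \<open>(x, y)\<close> itself, giving a loop at \<open>x\<close> in
  \<open>G\<close>. Hence the two counts add.\<close>

lemma cartesian_product_neighbors_card:
  assumes "pair_bidirected_digraph G" and "x \<in> pverts G" and "y \<in> pverts H"
    and "finite {x'. (x, x') \<in> parcs G \<and> P (x', y)}"
    and "finite {y'. (y, y') \<in> parcs H \<and> P (x, y')}"
  shows "finite {w. ((x, y), w) \<in> parcs (G \<box> H) \<and> P w}"
    and "card {w. ((x, y), w) \<in> parcs (G \<box> H) \<and> P w}
      = card {x'. (x, x') \<in> parcs G \<and> P (x', y)} + card {y'. (y, y') \<in> parcs H \<and> P (x, y')}"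
proof -
  interpret G: pair_bidirected_digraph G by (rule assms(1))
  have disj: "(\<lambda>x'. (x', y)) ` {x'. (x, x') \<in> parcs G \<and> P (x', y)}
      \<inter> Pair x ` {y'. (y, y') \<in> parcs H \<and> P (x, y')} = {}"
    by (auto dest: G.pair_no_loops)
  show "finite {w. ((x, y), w) \<in> parcs (G \<box> H) \<and> P w}"
    using assms(4,5) by (simp add: cartesian_product_neighbors[OF assms(2,3)])
  show "card {w. ((x, y), w) \<in> parcs (G \<box> H) \<and> P w}
      = card {x'. (x, x') \<in> parcs G \<and> P (x', y)} + card {y'. (y, y') \<in> parcs H \<and> P (x, y')}"
    using assms(4,5) disj
    by (simp add: cartesian_product_neighbors[OF assms(2,3)] card_Un_disjoint card_image inj_on_def)
qed

theorem theorem2: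
  fixes G :: "'a pair_pre_digraph" and H :: "'b pair_pre_digraph"
    and k l :: nat and ks :: "nat \<Rightarrow> nat"
    and A :: "nat \<Rightarrow> nat \<Rightarrow> int mat" and a :: "nat \<Rightarrow> nat \<Rightarrow> int" and B :: "nat \<Rightarrow> int mat"
    and g :: "'a \<Rightarrow> nat \<times> nat" and h :: "nat \<Rightarrow> 'b \<Rightarrow> nat"
  assumes "pair_bidirected_digraph G" and "pair_bidirected_digraph H"
    and "k = (\<Sum>i<l. ks i)" and "\<And>i. i < l \<Longrightarrow> ks i > 0"
    and "perfect_coloring G k (block_indices l ks) (block_matrix A) g"
    and "\<And>i. i < l \<Longrightarrow> equal_diagonal (ks i) (A i i)"
    and "\<And>i j. i < l \<Longrightarrow> j < l \<Longrightarrow> i \<noteq> j \<Longrightarrow> A i j = a i j \<cdot>\<^sub>m all_ones_mat (ks i) (ks j)"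
    and "\<And>i. i < l \<Longrightarrow> equal_diagonal (ks i) (B i)"
    and "\<And>i. i < l \<Longrightarrow> perfect_coloring H (ks i) {..<ks i} (\<lambda>p q. B i $$ (p, q)) (h i)"
  shows "\<exists>f. perfect_coloring (G \<box> H) k (block_indices l ks)
           (block_matrix (\<lambda>i j. if i = j then A i i + B i else A i j)) f"
proof -
  interpret G: pair_bidirected_digraph G by (rule assms(1))
  interpret H: pair_bidirected_digraph H by (rule assms(2))
  define f where
    "f = (\<lambda>(x, y). (fst (g x), (snd (g x) + h (fst (g x)) y) mod ks (fst (g x))))"
  have f_eq: "f (x, y) = (i, (p + h i y) mod ks i)" if "g x = (i, p)" for x y i p
    using that by (simp add: f_def)
  have h_less: "h i y < ks i" if "i < l" "y \<in> pverts H" for i y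
    using perfect_coloring_in_colors[OF assms(9)] that by simp
  have g_less: "fst (g x) < l" "snd (g x) < ks (fst (g x))" if "x \<in> pverts G" for x
    using perfect_coloring_in_colors[OF assms(5) that] by (auto simp: block_indices_def)
  have "f ` pverts (G \<box> H) = block_indices l ks"
  proof
    show "f ` pverts (G \<box> H) \<subseteq> block_indices l ks"
      using g_less assms(4) by (auto simp: f_def block_indices_def cartesian_product_def)
  next
    show "block_indices l ks \<subseteq> f ` pverts (G \<box> H)"
    proof
      fix c
      assume "c \<in> block_indices l ks"
      then obtain i q where c: "c = (i, q)" "i < l" "q < ks i" "(i, q) \<in> block_indices l ks"
        by (auto simp: block_indices_def)
      have "g ` pverts G = block_indices l ks"
        using assms(5) by (simp add: perfect_coloring_def coloring_def)
      then obtain x where x: "x \<in> pverts G" "g x = (i, q)"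
        using c(4) by (metis (no_types) imageE)
      have "h i ` pverts H = {..<ks i}"
        using assms(9)[OF c(2)] by (simp add: perfect_coloring_def coloring_def)
      \<comment> \<open>With \<open>h i y = 0\<close> the shift is trivial, so
        \<open>f (x, y)\<close> equals \<open>g x\<close>.\<close>
      then obtain y where y: "y \<in> pverts H" "h i y = 0"
        using assms(4)[OF c(2)] by (metis image_iff lessThan_iff)
      have "f (x, y) = c" using x y c by (simp add: f_eq)
      then show "c \<in> f ` pverts (G \<box> H)" using x y by (force simp: cartesian_product_def)
    qed
  qed
  then have col: "coloring (G \<box> H) k (block_indices l ks) f"
    by (simp add: coloring_def finite_block_indices card_block_indices assms(3))
  let ?M = "block_matrix (\<lambda>i j. if i = j then A i i + B i else A i j)"
  have count: "finite {w. (v, w) \<in> parcs (G \<box> H) \<and> f w = d} \<and>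
      int (card {w. (v, w) \<in> parcs (G \<box> H) \<and> f w = d}) = ?M (f v) d"
    if v: "v \<in> pverts (G \<box> H)" and d: "d \<in> block_indices l ks" for v d
  proof -
    obtain x y where xy: "v = (x, y)" "x \<in> pverts G" "y \<in> pverts H"
      using v by (auto simp: cartesian_product_def)
    obtain i p where gx: "g x = (i, p)" by fastforce
    have i: "i < l" and p: "p < ks i" using g_less[OF xy(2)] gx by simp_all
    obtain j c where jc: "d = (j, c)" "j < l" "c < ks j" using d by (auto simp: block_indices_def)
    \<comment> \<open>The position of the color of \<open>v\<close> inside block \<open>i\<close>.
      The counts along \<open>G\<close> and along \<open>H\<close> are both rewritten to row
      \<open>?r\<close> and column \<open>c\<close>, so that they sum to a single entry of the
      block.\<close>
    let ?r = "(p + h i y) mod ks i"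
    let ?X = "{x'. (x, x') \<in> parcs G \<and> f (x', y) = (j, c)}"
    let ?Y = "{y'. (y, y') \<in> parcs H \<and> f (x, y') = (j, c)}"
    have r: "?r < ks i" using p by simp
    have X: "finite ?X \<and> int (card ?X) = A i j $$ (?r, c)"
    proof -
      \<comment> \<open>Along \<open>G\<close> the vertex \<open>y\<close> is fixed, so every
        neighbor whose \<open>g\<close>-color lies in block \<open>j\<close> is shifted by the same
        amount \<open>h j y\<close>.\<close>
      obtain p' where p': "p' < ks j" "(p' + h j y) mod ks j = c"
        "\<And>q. q < ks j \<Longrightarrow> (q + h j y) mod ks j = c \<longleftrightarrow> q = p'"
        using mod_add_eq_unique[OF jc(3)] by blast
      have "f (x', y) = (j, c) \<longleftrightarrow> g x' = (j, p')" if "x' \<in> pverts G" for x'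
        using p' g_less[OF that] by (cases "g x'") (auto simp: f_eq)
      then have X_eq: "?X = {x'. (x, x') \<in> parcs G \<and> g x' = (j, p')}"
        using G.in_arcsD2 by blast
      have "(j, p') \<in> block_indices l ks" using p' jc by (simp add: block_indices_def)
      from perfect_coloring_card[OF assms(5) xy(2) this]
      have "finite ?X" "int (card ?X) = A i j $$ (p, p')"
        by (simp_all add: X_eq gx block_matrix_def)
      \<comment> \<open>In a diagonal block, row and column move by the same amount
        \<open>h i y\<close>. In an off-diagonal block the amounts \<open>h i y\<close> and
        \<open>h j y\<close> may differ, but the block is constant.\<close>
      moreover have "A i j $$ (p, p') = A i j $$ (?r, c)"
      proof (cases "i = j")
        case True
        then show ?thesis
          using equal_diagonal_shift[OF assms(6)[OF i], of p p' "h i y"] p p' by simp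
      next
        case False
        then show ?thesis
          using assms(7)[OF i jc(2)] p p'(1) r jc by (simp add: all_ones_mat_def)
      qed
      ultimately show ?thesis by simp
    qed
    have Y: "finite ?Y \<and> int (card ?Y) = (if i = j then B i $$ (?r, c) else 0)"
    proof (cases "i = j")
      case False
      \<comment> \<open>Moving along \<open>H\<close> keeps \<open>x\<close>, hence the block number
        \<open>i\<close>.\<close>
      then have "?Y = {}" by (auto simp: f_eq[OF gx])
      then show ?thesis using False by (simp only: finite.emptyI card.empty) simp
    next
      case True
      \<comment> \<open>The roles are exchanged: \<open>x\<close> is fixed, so its position
        \<open>p\<close> is now the shift, applied to the colors of \<open>h i\<close>. The
        invariance of \<open>B i\<close> under this shift leads to the same row
        \<open>?r\<close>.\<close>
      obtain b where b: "b < ks i" "(b + p) mod ks i = c"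
        "\<And>q. q < ks i \<Longrightarrow> (q + p) mod ks i = c \<longleftrightarrow> q = b"
        using mod_add_eq_unique[of c "ks i" p] jc(3) True by blast
      have "f (x, y') = (j, c) \<longleftrightarrow> h i y' = b" if "y' \<in> pverts H" for y'
        using b(3)[OF h_less[OF i that]] True by (simp add: f_eq[OF gx] add.commute)
      then have Y_eq: "?Y = {y'. (y, y') \<in> parcs H \<and> h i y' = b}"
        using H.in_arcsD2 by blast
      have "b \<in> {..<ks i}" using b by simp
      from perfect_coloring_card[OF assms(9)[OF i] xy(3) this]
      have "finite ?Y" "int (card ?Y) = B i $$ (h i y, b)"
        by (simp_all add: Y_eq)
      moreover have "B i $$ (h i y, b) = B i $$ (?r, c)"
        using equal_diagonal_shift[OF assms(8)[OF i] h_less[OF i xy(3)] b(1), of p] b(2)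
        by (simp add: add.commute)
      ultimately show ?thesis using True by simp
    qed
    \<comment> \<open>A matrix sum takes its dimensions from the second summand, so the bounds are
      checked against \<open>B i\<close>.\<close>
    have "(A i i + B i) $$ (?r, c) = A i i $$ (?r, c) + B i $$ (?r, c)" if "i = j"
      using equal_diagonal_carrier[OF assms(8)[OF i]] r jc that by simp
    then have "?M (f v) d = A i j $$ (?r, c) + (if i = j then B i $$ (?r, c) else 0)"
      using xy jc gx by (simp add: f_eq block_matrix_def)
    then show ?thesis
      using cartesian_product_neighbors_card[OF assms(1) xy(2,3), where P = "\<lambda>w. f w = (j, c)"] X Y
      by (simp add: xy(1) jc(1))
  qed
  show ?thesis
    using col count unfolding perfect_coloring_def by blast
qed

end
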